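(* Let $E\subset \mathbb{R}^2$ be compact and let $s > 0$. Define $$\sigma'(E,s):=\inf\{\mathcal{H}^1(T_X): X=\{x_i\}_{i=1}^N \text{ a finite set of points in } \mathbb{R}^2,\ B(X,s)\supset E\},$$ where $T_X$ denotes a minimum spanning tree over $X$. Then $\sigma'(E,s)=\lambda(E,s)$.
   Context: $\mathcal{H}^1$ denotes one-dimensional Hausdorff measure. For $A\subset\mathbb{R}^2$ and $r>0$, $B(A,r):=\{x\in\mathbb{R}^2:\mathrm{dist}(x,A)\le r\}$ is the closed $r$-neighborhood of $A$, where $\mathrm{dist}(x,A)=\inf\{|x-y|:y\in A\}$ and $|\cdot|$ is the Euclidean norm. The $s$-maximum distance length of a compact set $E\subset\mathbb{R}^2$ is $$\lambda(E,s):=\inf\{\mathcal{H}^1(K): K\subset\mathbb{R}^2 \text{ is closed, connected and } E\subset B(K,s)\}.$$ Minimum spanning tree: for a finite (nonempty) set of points $X=\{x_i\}_{i=1}^N\subset\mathbb{R}^2$, let $\mathscr{L}=\{[x,y]:x,y\in X\}$ be the collection of closed line segments with endpoints in $X$, and consider $$\min\Big\{\sum_{l\in\mathscr{E}}\mathcal{H}^1(l):\ \mathscr{E}\subset\mathscr{L},\ \bigcup_{l\in\mathscr{E}} l \text{ is connected and contains } X\Big\}.$$ If $\mathscr{E}_*$ is a minimizer, the union $T_X:=\bigcup_{l\in\mathscr{E}_*} l$ is called a minimum spanning tree over $X$. *)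

theory Defs
  imports "HOL-Analysis.Analysis"
begin

(* Boundedness of the covering sets is required explicitly because
   diameter is a real-valued supremum, unspecified on unbounded sets.
   Countable covers are sequences; finite covers are padded with the empty set,
   whose diameter is 0. No normalising constant is needed in dimension one. *)
definition hausdorff1_pre :: "real \<Rightarrow> 'a::metric_space set \<Rightarrow> ennreal" where
  "hausdorff1_pre \<delta> A =
     (INF U \<in> {U :: nat \<Rightarrow> 'a set.
                 A \<subseteq> (\<Union>i. U i) \<and> (\<forall>i. bounded (U i) \<and> diameter (U i) \<le> \<delta>)}.
        \<Sum>i. ennreal (diameter (U i)))"

definition hausdorff1 :: "'a::metric_space set \<Rightarrow> ennreal" where
  "hausdorff1 A = (SUP \<delta> \<in> {0<..}. hausdorff1_pre \<delta> A)"

(* The distance to A is an infimum in the extended reals, so that the distance to the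
   empty set is infinite; infdist would make every neighbourhood of {} the whole space. *)
definition closed_nbhd :: "'a::metric_space set \<Rightarrow> real \<Rightarrow> 'a set" where
  "closed_nbhd A r = {x. (INF y\<in>A. ereal (dist x y)) \<le> ereal r}"

definition max_dist_length :: "(real^2) set \<Rightarrow> real \<Rightarrow> ennreal" where
  "max_dist_length E s =
     (INF K \<in> {K. closed K \<and> connected K \<and> E \<subseteq> closed_nbhd K s}. hausdorff1 K)"

(* Degenerate segments [x,x] are included, so a singleton X is spanned by itself. *)
definition segments :: "(real^2) set \<Rightarrow> (real^2) set set" where
  "segments X = {closed_segment x y | x y. x \<in> X \<and> y \<in> X}"

definition spanning_segments :: "(real^2) set \<Rightarrow> (real^2) set set \<Rightarrow> bool" where
  "spanning_segments X \<E> \<longleftrightarrow> \<E> \<subseteq> segments X \<and> connected (\<Union>\<E>) \<and> X \<subseteq> \<Union>\<E>"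

definition minimum_spanning_tree :: "(real^2) set \<Rightarrow> (real^2) set \<Rightarrow> bool" where
  "minimum_spanning_tree X T \<longleftrightarrow>
     (\<exists>\<E>. is_arg_min (\<lambda>\<F>. \<Sum>l\<in>\<F>. hausdorff1 l) (spanning_segments X) \<E> \<and> T = \<Union>\<E>)"

(* Minimum spanning trees need not be unique; the infimum ranges over all of them. *)
definition mst_length :: "(real^2) set \<Rightarrow> real \<Rightarrow> ennreal" where
  "mst_length E s =
     Inf {hausdorff1 T | X T. finite X \<and> X \<noteq> {} \<and> E \<subseteq> closed_nbhd X s \<and>
                              minimum_spanning_tree X T}"

end

(* A minimum spanning tree is an admissible competitor for lambda, which gives one inequality.

   For the other one, cover a connected K of finite length by small open sets and join finitely
   many points of K along shortest chains of these sets. The resulting finite tree is not much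
   longer than K, but it only covers E at distance s + delta. To get back to s, let L be the limit
   as delta -> 0 of the infimal length of trees covering E at distance s + delta. Take a tree T
   almost optimal for a delta far below a scale eta, and cut T into about L / eta pieces of
   diameter O(eta) with at most two boundary points. Replacing every piece by the segment between its
   boundary points yields a tree that still covers E at distance s + O(eta); so it is not much
   shorter than L, i.e. the total excess length x of the pieces is small. A piece of excess x lies
   within O(sqrt(eta x)) of its segment, hence whiskers of this size (plus O(eta^2 / s)) at the
   boundary points suffice to cover at distance s whatever the piece covered at s + delta. By
   sqrt(eta x) <= a eta + x / a the total length of the whiskers is small. *)

theory Submission
  imports Defs
begin

subsection \<open>One-dimensional Hausdorff measure\<close>

lemma hausdorff1_pre_le:
  assumes "A \<subseteq> (\<Union>i. U i)" "\<And>i. bounded (U i)" "\<And>i. diameter (U i) \<le> \<delta>"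
  shows "hausdorff1_pre \<delta> A \<le> (\<Sum>i. ennreal (diameter (U i)))"
  unfolding hausdorff1_pre_def using assms by (intro INF_lower) auto

lemma hausdorff1_pre_Un: "hausdorff1_pre \<delta> (A \<union> B) \<le> hausdorff1_pre \<delta> A + hausdorff1_pre \<delta> B"
proof (rule ennreal_le_epsilon)
  fix e :: real
  assume "hausdorff1_pre \<delta> A + hausdorff1_pre \<delta> B < top" and e: "e > 0"
  then have fin: "hausdorff1_pre \<delta> A < top" "hausdorff1_pre \<delta> B < top"
    by (simp_all add: less_top)
  have "\<exists>U. S \<subseteq> (\<Union>i. U i) \<and> (\<forall>i. bounded (U i) \<and> diameter (U i) \<le> \<delta>) \<and>
        (\<Sum>i. ennreal (diameter (U i))) < hausdorff1_pre \<delta> S + ennreal (e/2)"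
    if "hausdorff1_pre \<delta> S < top" for S
  proof -
    have "hausdorff1_pre \<delta> S < hausdorff1_pre \<delta> S + ennreal (e/2)"
      using that e by (cases "hausdorff1_pre \<delta> S") (auto simp: ennreal_lessI simp flip: ennreal_plus)
    then show ?thesis
      by (subst (asm) (1) hausdorff1_pre_def) (auto simp: INF_less_iff)
  qed
  from this[OF fin(1)] this[OF fin(2)] obtain U V where
    U: "A \<subseteq> (\<Union>i. U i)" "\<And>i. bounded (U i)" "\<And>i. diameter (U i) \<le> \<delta>"
       "(\<Sum>i. ennreal (diameter (U i))) < hausdorff1_pre \<delta> A + ennreal (e/2)" and
    V: "B \<subseteq> (\<Union>i. V i)" "\<And>i. bounded (V i)" "\<And>i. diameter (V i) \<le> \<delta>"
       "(\<Sum>i. ennreal (diameter (V i))) < hausdorff1_pre \<delta> B + ennreal (e/2)"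
    by blast
  define W where "W n = (if even n then U (n div 2) else V (n div 2))" for n
  have W: "W (2*i) = U i" "W (2*i+1) = V i" for i
    by (auto simp: W_def)
  have "A \<union> B \<subseteq> (\<Union>i. W i)"
  proof -
    have "U i \<subseteq> (\<Union>i. W i)" "V i \<subseteq> (\<Union>i. W i)" for i
      by (metis W(1) UNIV_I UN_upper) (metis W(2) UNIV_I UN_upper)
    then have "(\<Union>i. U i) \<subseteq> (\<Union>i. W i)" "(\<Union>i. V i) \<subseteq> (\<Union>i. W i)"
      by (simp_all add: UN_least)
    then show ?thesis using U(1) V(1) by (meson Un_least order.trans)
  qed
  then have "hausdorff1_pre \<delta> (A \<union> B) \<le> (\<Sum>i. ennreal (diameter (W i)))"
    using U(2,3) V(2,3) by (intro hausdorff1_pre_le) (simp_all add: W_def)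
  also have "\<dots> \<le> (\<Sum>i. ennreal (diameter (U i))) + (\<Sum>i. ennreal (diameter (V i)))"
  proof (intro suminf_le_const)
    fix n
    \<comment> \<open>The first \<open>n\<close> terms of the interleaved series are among its first
      \<open>2*n\<close> terms, and a partial sum of even length splits exactly into one partial sum
      for each cover.\<close>
    have *: "(\<Sum>i<2*n. ennreal (diameter (W i))) =
        (\<Sum>i<n. ennreal (diameter (U i))) + (\<Sum>i<n. ennreal (diameter (V i)))" for n
      by (induction n) (use W in \<open>auto simp: algebra_simps\<close>)
    have "(\<Sum>i<n. ennreal (diameter (W i))) \<le> (\<Sum>i<2*n. ennreal (diameter (W i)))"
      by (intro sum_mono2) auto
    also have "\<dots> \<le> (\<Sum>i. ennreal (diameter (U i))) + (\<Sum>i. ennreal (diameter (V i)))"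
      unfolding * by (intro add_mono sum_le_suminf) auto
    finally show "(\<Sum>i<n. ennreal (diameter (W i))) \<le>
        (\<Sum>i. ennreal (diameter (U i))) + (\<Sum>i. ennreal (diameter (V i)))" .
  qed auto
  also have "\<dots> \<le> (hausdorff1_pre \<delta> A + ennreal (e/2)) + (hausdorff1_pre \<delta> B + ennreal (e/2))"
    using U(4) V(4) by (intro add_mono) auto
  also have "\<dots> = hausdorff1_pre \<delta> A + hausdorff1_pre \<delta> B + (ennreal (e/2) + ennreal (e/2))"
    by (simp add: ac_simps)
  also have "ennreal (e/2) + ennreal (e/2) = ennreal e"
    using e by (simp flip: ennreal_plus)
  finally show "hausdorff1_pre \<delta> (A \<union> B) \<le> hausdorff1_pre \<delta> A + hausdorff1_pre \<delta> B + ennreal e" .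
qed

lemma hausdorff1_Un: "hausdorff1 (A \<union> B) \<le> hausdorff1 A + hausdorff1 B"
  unfolding hausdorff1_def
proof (rule SUP_least)
  fix d :: real assume "d \<in> {0<..}"
  then show "hausdorff1_pre d (A \<union> B) \<le>
      (SUP d\<in>{0<..}. hausdorff1_pre d A) + (SUP d\<in>{0<..}. hausdorff1_pre d B)"
    by (intro order.trans[OF hausdorff1_pre_Un] add_mono SUP_upper)
qed

lemma hausdorff1_empty [simp]: "hausdorff1 {} = 0"
proof -
  have "hausdorff1_pre d ({} :: 'a set) \<le> 0" if "d > 0" for d
    using hausdorff1_pre_le[of "{} :: 'a set" "\<lambda>_. {}" d] that by simp
  then have "hausdorff1 ({} :: 'a set) \<le> 0"
    unfolding hausdorff1_def by (intro SUP_least) simp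
  then show ?thesis by simp
qed

lemma hausdorff1_Union:
  "finite F \<Longrightarrow> hausdorff1 (\<Union>F) \<le> (\<Sum>l\<in>F. hausdorff1 l)"
proof (induction F rule: finite_induct)
  case (insert l F)
  have "hausdorff1 (\<Union>(insert l F)) \<le> hausdorff1 l + hausdorff1 (\<Union>F)"
    using hausdorff1_Un[of l "\<Union>F"] by simp
  also have "\<dots> \<le> hausdorff1 l + (\<Sum>l\<in>F. hausdorff1 l)"
    using insert.IH by (rule add_left_mono)
  finally show ?case using insert.hyps by simp
qed auto

text \<open>Cutting the segment into \<open>n\<close> equal pieces no longer than \<delta> gives a
  cover of total diameter at most \<open>dist x y\<close>, for every \<delta>.\<close>

lemma hausdorff1_closed_segment:
  fixes x y :: "'a::real_normed_vector"
  shows "hausdorff1 (closed_segment x y) \<le> ennreal (dist x y)"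
  unfolding hausdorff1_def
proof (rule SUP_least)
  fix \<delta> :: real assume "\<delta> \<in> {0<..}"
  then have d: "\<delta> > 0" by simp
  obtain n :: nat where n: "dist x y / \<delta> < n"
    using reals_Archimedean2 by blast
  have n0: "n > 0"
  proof (rule ccontr)
    assume "\<not> n > 0"
    moreover have "0 \<le> dist x y / \<delta>" using d by simp
    ultimately show False using n by linarith
  qed
  have nd: "dist x y / n \<le> \<delta>"
    using n d n0 by (simp add: field_simps)
  define U where "U i = (if i < n then (\<lambda>t. x + t *\<^sub>R (y - x)) ` {real i / n .. (real i + 1) / n} else {})"
    for i :: nat
  have diam: "bounded (U i) \<and> diameter (U i) \<le> (if i < n then dist x y / n else 0)" for i
  proof (cases "i < n")
    case True
    have *: "dist p q \<le> dist x y / n" if pq: "p \<in> U i" "q \<in> U i" for p q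
    proof -
      obtain t u where tu: "p = x + t *\<^sub>R (y - x)" "q = x + u *\<^sub>R (y - x)"
        "real i / n \<le> t" "t \<le> (real i + 1) / n" "real i / n \<le> u" "u \<le> (real i + 1) / n"
        using pq True unfolding U_def by (force simp del: real_vector.scale_cancel_right scaleR_cancel_right)
      have "\<bar>t - u\<bar> \<le> 1 / n"
        using tu n0 by (auto simp: add_divide_distrib abs_if)
      moreover have "dist p q = \<bar>t - u\<bar> * dist x y"
      proof -
        have "p - q = (t - u) *\<^sub>R (y - x)"
          by (simp add: tu(1,2) algebra_simps)
        then show ?thesis by (simp add: dist_norm norm_minus_commute)
      qed
      ultimately show ?thesis
        using mult_right_mono[of "\<bar>t - u\<bar>" "1/n" "dist x y"] by simp
    qed
    have "bounded (U i)"
      using * by (auto simp: bounded_two_points)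
    moreover have "diameter (U i) \<le> dist x y / n"
      using * by (intro diameter_le) (auto simp: dist_norm)
    ultimately show ?thesis using True by simp
  qed (auto simp: U_def)
  have cover: "closed_segment x y \<subseteq> (\<Union>i. U i)"
  proof
    fix p assume "p \<in> closed_segment x y"
    then obtain t where t: "0 \<le> t" "t \<le> 1" "p = x + t *\<^sub>R (y - x)"
      by (auto simp: in_segment algebra_simps)
    show "p \<in> (\<Union>i. U i)"
    \<comment> \<open>At \<open>t = 1\<close> the rounded index would be \<open>n\<close>, where
      \<open>U\<close> is empty; the end point belongs to the last piece.\<close>
    proof (cases "t = 1")
      case True
      have "p \<in> U (n - 1)"
        using n0 t True by (auto simp: U_def of_nat_diff intro!: image_eqI[of _ _ 1])
      then show ?thesis by blast
    next
      case False
      define i where "i = nat \<lfloor>t * n\<rfloor>"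
      have i: "real i \<le> t * n" "t * n \<le> real i + 1"
        using t n0 by (auto simp: i_def)
      have "real i < n"
        using i False t n0 by (smt (verit) mult_le_cancel_right2 of_nat_0_less_iff mult_less_cancel_right2)
      then have "p \<in> U i"
        using i n0 t by (auto simp: U_def field_simps intro!: image_eqI[of _ _ t])
      then show ?thesis by blast
    qed
  qed
  have "hausdorff1_pre \<delta> (closed_segment x y) \<le> (\<Sum>i. ennreal (diameter (U i)))"
  proof (intro hausdorff1_pre_le cover)
    show "bounded (U i)" for i using diam by blast
    show "diameter (U i) \<le> \<delta>" for i using diam[of i] nd d by (cases "i < n") simp_all
  qed
  also have "\<dots> = (\<Sum>i<n. ennreal (diameter (U i)))"
    by (intro suminf_finite) (auto simp: U_def)
  also have "\<dots> \<le> (\<Sum>i<n. ennreal (dist x y / n))"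
  proof (intro sum_mono ennreal_leI)
    show "diameter (U i) \<le> dist x y / n" if "i \<in> {..<n}" for i using diam[of i] that by simp
  qed
  also have "\<dots> = ennreal (dist x y)"
    using n0 by (simp add: ennreal_of_nat_eq_real_of_nat flip: ennreal_mult')
  finally show "hausdorff1_pre \<delta> (closed_segment x y) \<le> ennreal (dist x y)" .
qed

section \<open>Closed neighbourhoods\<close>

lemma closed_nbhd_mono: "A \<subseteq> B \<Longrightarrow> closed_nbhd A r \<subseteq> closed_nbhd B r"
  unfolding closed_nbhd_def using INF_superset_mono[of A B] by (blast intro: order.trans)

lemma closed_nbhdI: "y \<in> A \<Longrightarrow> dist x y \<le> r \<Longrightarrow> x \<in> closed_nbhd A r"
  unfolding closed_nbhd_def by (auto intro: INF_lower2)

text \<open>The infimum need not be attained, so a near point is available only for a larger radius.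
  This is the source of the excess \<delta> in the covering distance.\<close>

lemma closed_nbhdD:
  assumes "x \<in> closed_nbhd A r" "r < r'"
  obtains y where "y \<in> A" "dist x y < r'"
proof -
  have "(INF y\<in>A. ereal (dist x y)) < ereal r'"
    using assms unfolding closed_nbhd_def by (auto intro: le_less_trans)
  then show ?thesis using that by (auto simp: INF_less_iff)
qed

subsection \<open>Networks\<close>

text \<open>Trees with a marked vertex, their origin; \<open>Graft a b\<close> joins the origins of \<open>a\<close> and \<open>b\<close> by an
  edge.\<close>

datatype 'a network = Point 'a | Graft "'a network" "'a network"

primrec origin :: "'a network \<Rightarrow> 'a" where
  "origin (Point x) = x"
| "origin (Graft a b) = origin a"

primrec verts :: "'a network \<Rightarrow> 'a set" where
  "verts (Point x) = {x}"
| "verts (Graft a b) = verts a \<union> verts b"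

primrec len :: "'a::metric_space network \<Rightarrow> real" where
  "len (Point x) = 0"
| "len (Graft a b) = len a + len b + dist (origin a) (origin b)"

text \<open>Networks are cut at vertices only, so cutting at scale \<eta> requires that no edge is
  longer than \<eta>.\<close>

primrec mesh_le :: "real \<Rightarrow> 'a::metric_space network \<Rightarrow> bool" where
  "mesh_le d (Point x) \<longleftrightarrow> True"
| "mesh_le d (Graft a b) \<longleftrightarrow> mesh_le d a \<and> mesh_le d b \<and> dist (origin a) (origin b) \<le> d"

text \<open>The degenerate segment at a leaf lets a one-point network span its vertex.\<close>

primrec segs :: "'a::real_vector network \<Rightarrow> 'a set set" where
  "segs (Point x) = {closed_segment x x}"
| "segs (Graft a b) = segs a \<union> segs b \<union> {closed_segment (origin a) (origin b)}"

lemma origin_in_verts [simp]: "origin T \<in> verts T"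
  by (induction T) auto

lemma finite_verts [simp]: "finite (verts T)"
  by (induction T) auto

lemma len_nonneg [simp]: "0 \<le> len T"
  by (induction T) auto

lemma mesh_le_mono: "mesh_le d T \<Longrightarrow> d \<le> d' \<Longrightarrow> mesh_le d' T"
  by (induction T) auto

lemma dist_origin_le_len: "v \<in> verts T \<Longrightarrow> dist (origin T) v \<le> len T"
proof (induction T)
  case (Graft a b)
  show ?case
  proof (cases "v \<in> verts a")
    case True
    then show ?thesis using Graft.IH(1) len_nonneg[of b] zero_le_dist[of "origin a" "origin b"]
      unfolding len.simps origin.simps by linarith
  next
    case False
    then have "dist (origin b) v \<le> len b" using Graft by auto
    then show ?thesis
      using len_nonneg[of a] dist_triangle[of "origin a" v "origin b"] unfolding len.simps origin.simps by linarith
  qed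
qed auto

text \<open>The induction descends to a leaf \<open>Point z\<close> and replaces it by an edge from
  \<open>z\<close> to \<open>y\<close>. Origins are preserved on the way, so all other edges keep
  their lengths.\<close>

lemma network_insert:
  assumes "z \<in> verts T"
  shows "\<exists>T'. origin T' = origin T \<and> verts T' = insert y (verts T) \<and> len T' = len T + dist z y \<and>
           (\<forall>d. mesh_le d T \<and> dist z y \<le> d \<longrightarrow> mesh_le d T')"
  using assms
proof (induction T)
  case (Point x)
  then show ?case by (intro exI[of _ "Graft (Point x) (Point y)"]) auto
next
  case (Graft a b)
  then consider "z \<in> verts a" | "z \<in> verts b" by auto
  then show ?case
  proof cases
    case 1
    with Graft obtain a' where "origin a' = origin a" "verts a' = insert y (verts a)" 
      "len a' = len a + dist z y" "\<forall>d. mesh_le d a \<and> dist z y \<le> d \<longrightarrow> mesh_le d a'" by blast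
    then show ?thesis by (intro exI[of _ "Graft a' b"]) auto
  next
    case 2
    with Graft obtain b' where "origin b' = origin b" "verts b' = insert y (verts b)" 
      "len b' = len b + dist z y" "\<forall>d. mesh_le d b \<and> dist z y \<le> d \<longrightarrow> mesh_le d b'" by blast
    then show ?thesis by (intro exI[of _ "Graft a b'"]) auto
  qed
qed

lemma finite_segs [simp]: "finite (segs T)"
  by (induction T) auto

lemma verts_subset_segs: "verts T \<subseteq> \<Union>(segs T)"
  by (induction T) auto

lemma connected_segs: 
  fixes T :: "'a::real_normed_vector network"
  shows "connected (\<Union>(segs T))"
proof (induction T)
  case (Graft a b)
  have "origin a \<in> \<Union>(segs a)" "origin b \<in> \<Union>(segs b)"
    using verts_subset_segs origin_in_verts by blast+
  then have "connected (\<Union>(segs a) \<union> closed_segment (origin a) (origin b) \<union> \<Union>(segs b))"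
    using Graft by (intro connected_Un) auto
  then show ?case by (simp add: Un_ac)
qed auto

lemma segs_subset_segments: "segs T \<subseteq> segments (verts T)"
proof (induction T)
  case (Graft a b)
  moreover have "segments A \<subseteq> segments B" if "A \<subseteq> B" for A B
    using that unfolding segments_def by blast
  ultimately have "segs a \<subseteq> segments (verts (Graft a b))" "segs b \<subseteq> segments (verts (Graft a b))"
    by (metis Un_upper1 Un_upper2 order.trans verts.simps(2))+
  moreover have "closed_segment (origin a) (origin b) \<in> segments (verts (Graft a b))"
    unfolding segments_def using origin_in_verts by fastforce
  ultimately show ?case by simp
qed (auto simp: segments_def)

text \<open>Edges that coincide as segments count once on the left but repeatedly in
  \<open>len T\<close>.\<close>

lemma sum_segs_le: 
  fixes T :: "'a::real_normed_vector network"
  shows "(\<Sum>l\<in>segs T. hausdorff1 l) \<le> ennreal (len T)"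
proof (induction T)
  case (Point x)
  then show ?case using hausdorff1_closed_segment[of x x] by simp
next
  case (Graft a b)
  let ?l = "closed_segment (origin a) (origin b)"
  have "(\<Sum>l\<in>segs (Graft a b). hausdorff1 l) \<le> (\<Sum>l\<in>segs a \<union> segs b. hausdorff1 l) + hausdorff1 ?l"
    by (cases "?l \<in> segs a \<union> segs b") (simp_all add: insert_absorb add.commute)
  also have "(\<Sum>l\<in>segs a \<union> segs b. hausdorff1 l) \<le> (\<Sum>l\<in>segs a. hausdorff1 l) + (\<Sum>l\<in>segs b. hausdorff1 l)"
    unfolding sum.union_inter[OF finite_segs finite_segs, symmetric] by (simp add: le_iff_add)
  also have "\<dots> + hausdorff1 ?l \<le> ennreal (len a) + ennreal (len b) + ennreal (dist (origin a) (origin b))"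
    using Graft hausdorff1_closed_segment by (intro add_mono) auto
  also have "\<dots> = ennreal (len (Graft a b))"
    by (simp flip: ennreal_plus)
  finally show ?case by simp
qed

subsection \<open>Minimum spanning trees\<close>

lemma finite_segments: "finite X \<Longrightarrow> finite (segments X)"
proof -
  assume "finite X"
  moreover have "segments X = (\<lambda>(x,y). closed_segment x y) ` (X \<times> X)"
    by (auto simp: segments_def)
  ultimately show ?thesis by simp
qed

lemma finite_spanning_segments: "finite X \<Longrightarrow> finite (Collect (spanning_segments X))"
  by (rule finite_subset[of _ "Pow (segments X)"])
     (auto simp: spanning_segments_def finite_segments)

text \<open>Only finitely many families of segments span \<open>X\<close>, so a minimizer exists.
  Subadditivity passes from the sum over its segments to the measure of their union.\<close>

lemma minimum_spanning_tree_le: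
  assumes "spanning_segments X F" "finite X"
  obtains T where "minimum_spanning_tree X T" "hausdorff1 T \<le> (\<Sum>l\<in>F. hausdorff1 l)"
proof -
  let ?f = "\<lambda>G. \<Sum>l\<in>G. hausdorff1 l"
  obtain G where G: "is_arg_min ?f (spanning_segments X) G"
    using ex_is_arg_min_if_finite[OF finite_spanning_segments[OF assms(2)], of ?f] assms
    by (auto simp: is_arg_min_def)
  then have "spanning_segments X G" "?f G \<le> ?f F"
    using assms by (auto simp: is_arg_min_linorder)
  then have "finite G"
    using assms finite_segments unfolding spanning_segments_def by (meson finite_subset)
  then have "hausdorff1 (\<Union>G) \<le> ?f F"
    using hausdorff1_Union \<open>?f G \<le> ?f F\<close> by (meson order.trans)
  then show ?thesis
    using that[of "\<Union>G"] G unfolding minimum_spanning_tree_def by blast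
qed

text \<open>The edges of any network span its vertices, so a minimum spanning tree over these is no
  longer. It thus suffices to construct short networks, minimal or not.\<close>

lemma mst_length_le_len:
  assumes "E \<subseteq> closed_nbhd (verts T) s"
  shows "mst_length E s \<le> ennreal (len T)"
proof -
  have "spanning_segments (verts T) (segs T)"
    unfolding spanning_segments_def
    using segs_subset_segments connected_segs verts_subset_segs by blast
  then obtain M where "minimum_spanning_tree (verts T) M"
      "hausdorff1 M \<le> (\<Sum>l\<in>segs T. hausdorff1 l)"
    using minimum_spanning_tree_le by (metis finite_verts)
  moreover have "verts T \<noteq> {}"
    using origin_in_verts[of T] by blast
  ultimately have "mst_length E s \<le> hausdorff1 M"
    unfolding mst_length_def using assms finite_verts by (intro Inf_lower) blast
  also have "\<dots> \<le> ennreal (len T)"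
    using \<open>hausdorff1 M \<le> _\<close> sum_segs_le by (rule order.trans)
  finally show ?thesis .
qed

lemma max_dist_length_le_mst_length: "max_dist_length E s \<le> mst_length E s"
  unfolding mst_length_def
proof (rule Inf_greatest, clarify)
  fix X T
  assume *: "finite X" "X \<noteq> {}" "E \<subseteq> closed_nbhd X s" "minimum_spanning_tree X T"
  then obtain F where F: "spanning_segments X F" "T = \<Union>F"
    unfolding minimum_spanning_tree_def is_arg_min_def by blast
  then have "finite F"
    using * finite_segments unfolding spanning_segments_def by (meson finite_subset)
  moreover have "closed l" if "l \<in> F" for l
    using F that unfolding spanning_segments_def segments_def by auto
  ultimately have "closed T" "connected T" "E \<subseteq> closed_nbhd T s"
    using F * closed_nbhd_mono[of X T s] unfolding spanning_segments_def by auto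
  then show "max_dist_length E s \<le> hausdorff1 T"
    unfolding max_dist_length_def by (intro INF_lower) auto
qed

subsection \<open>Short networks in a connected set\<close>

text \<open>A cover as in the definition of Hausdorff measure, after enlarging its sets to open ones
  so that connectedness of \<open>K\<close> can be applied to unions of them. \<open>M\<close>
  bounds all finite sums of the diameter bounds \<open>d\<close>.\<close>

locale small_cover =
  fixes V :: "nat \<Rightarrow> 'a::metric_space set" and d :: "nat \<Rightarrow> real" and K :: "'a set"
    and \<delta> M :: real
  assumes open_V: "\<And>i. open (V i)"
    and cover: "K \<subseteq> (\<Union>i. V i)"
    and dist_le: "\<And>i x y. x \<in> V i \<Longrightarrow> y \<in> V i \<Longrightarrow> dist x y \<le> d i"
    and d_nonneg: "\<And>i. 0 \<le> d i"
    and d_le: "\<And>i. d i \<le> \<delta>"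
    and sum_d_le: "\<And>J. finite J \<Longrightarrow> sum d J \<le> M"
    and connected_K: "connected K"
begin

definition adj :: "(nat \<times> nat) set" where
  "adj = {(i, j). V i \<inter> V j \<noteq> {}}"

text \<open>Otherwise the union of the sets reachable from \<open>I\<close> and the union of all
  other sets would be disjoint open sets separating \<open>K\<close>.\<close>

lemma reachable:
  assumes "i \<in> I" "x \<in> V i" "x \<in> K" "y \<in> K"
  shows "\<exists>n j. j \<in> (adj ^^ n) `` I \<and> y \<in> V j"
proof (rule ccontr)
  assume contra: "\<not> ?thesis"
  define R where "R = adj\<^sup>* `` I"
  have R: "j \<in> R \<longleftrightarrow> (\<exists>n. j \<in> (adj ^^ n) `` I)" for j
    unfolding R_def rtrancl_is_UN_relpow by blast
  have "i \<in> R"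
    using assms(1) unfolding R_def by blast
  have "\<Union>(V ` R) \<inter> \<Union>(V ` (- R)) = {}"
  proof -
    have "V j \<inter> V k = {}" if "j \<in> R" "k \<notin> R" for j k
      using that unfolding R_def adj_def by (auto intro: rtrancl.rtrancl_into_rtrancl)
    then show ?thesis by blast
  qed
  moreover have "K \<subseteq> \<Union>(V ` R) \<union> \<Union>(V ` (- R))"
    using cover by blast
  moreover have "\<Union>(V ` R) \<inter> K \<noteq> {}"
    using assms \<open>i \<in> R\<close> by blast
  moreover have "\<Union>(V ` (- R)) \<inter> K \<noteq> {}"
  proof -
    obtain j where j: "y \<in> V j" using cover assms(4) by auto
    then have "j \<notin> R" using contra R by auto
    then show ?thesis using j assms(4) by auto
  qed
  moreover have "open (\<Union>(V ` R))" "open (\<Union>(V ` (- R)))"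
    using open_V by auto
  ultimately show False
    using connectedD[OF connected_K, of "\<Union>(V ` R)" "\<Union>(V ` (- R))"] by blast
qed

text \<open>The indices of a shortest chain of sets have pairwise different distances from \<open>I\<close>, hence
  every set is charged at most once.\<close>

lemma extend_along_chain:
  assumes I: "\<And>i. i \<in> I \<Longrightarrow> V i \<inter> verts T \<noteq> {}" "finite I" and mesh: "mesh_le \<delta> T"
    and n: "j \<in> (adj ^^ n) `` I" "\<And>m. m < n \<Longrightarrow> j \<notin> (adj ^^ m) `` I" and y: "y \<in> V j"
  shows "\<exists>T' J. finite J \<and> I \<subseteq> J \<and> (\<forall>i\<in>J. \<exists>m\<le>n. i \<in> (adj ^^ m) `` I) \<and> mesh_le \<delta> T' \<and>
      insert y (verts T) \<subseteq> verts T' \<and> (\<forall>i\<in>J. V i \<inter> verts T' \<noteq> {}) \<and>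
      len T' - sum d J \<le> len T - sum d I + \<delta>"
  using n y
proof (induction n arbitrary: j y)
  case 0
  then obtain z where z: "z \<in> V j" "z \<in> verts T" using I by auto
  \<comment> \<open>The set \<open>j\<close> is already charged, so this edge is the one paid by the
    extra \<delta>.\<close>
  have "dist z y \<le> \<delta>"
    using dist_le[of z j y] d_le[of j] 0 z by simp
  moreover obtain T' where "verts T' = insert y (verts T)" "len T' = len T + dist z y"
    "\<forall>d. mesh_le d T \<and> dist z y \<le> d \<longrightarrow> mesh_le d T'"
    using network_insert[OF z(2), of y] by blast
  ultimately show ?case
    using I mesh by (intro exI[of _ T'] exI[of _ I]) auto
next
  case (Suc n)
  then obtain k where k: "k \<in> (adj ^^ n) `` I" "(k, j) \<in> adj" by auto
  then obtain z where z: "z \<in> V k" "z \<in> V j" by (auto simp: adj_def)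
  have "k \<notin> (adj ^^ m) `` I" if "m < n" for m
    using that Suc.prems(2)[of "Suc m"] k(2) by auto
  from Suc.IH[OF k(1) this z(1)] obtain T' J where J: "finite J" "I \<subseteq> J"
      "\<forall>i\<in>J. \<exists>m\<le>n. i \<in> (adj ^^ m) `` I" "mesh_le \<delta> T'" "insert z (verts T) \<subseteq> verts T'"
      "\<forall>i\<in>J. V i \<inter> verts T' \<noteq> {}" "len T' - sum d J \<le> len T - sum d I + \<delta>"
    by metis
  \<comment> \<open>All sets in \<open>J\<close> have distance at most \<open>n\<close> from
    \<open>I\<close>, whereas \<open>j\<close> has distance \<open>Suc n\<close>; hence
    \<open>d j\<close> is still available to pay for the edge from \<open>z\<close> to
    \<open>y\<close>.\<close>
  have "j \<notin> J"
    using J(3) Suc.prems(2) by (metis less_Suc_eq_le)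
  have zy: "dist z y \<le> d j"
    using dist_le z Suc.prems by blast
  obtain T'' where T'': "verts T'' = insert y (verts T')" "len T'' = len T' + dist z y"
    "\<forall>d. mesh_le d T' \<and> dist z y \<le> d \<longrightarrow> mesh_le d T''"
    using network_insert[of z T' y] J(5) by blast
  have "\<forall>i\<in>insert j J. \<exists>m\<le>Suc n. i \<in> (adj ^^ m) `` I"
    using J(3) Suc.prems(1) by (metis insert_iff le_SucI order_refl)
  moreover have "\<forall>i\<in>insert j J. V i \<inter> verts T'' \<noteq> {}"
    using J(6) T''(1) Suc.prems(3) by auto
  moreover have "mesh_le \<delta> T''"
    using T''(3) J(4) zy d_le[of j] by auto
  moreover have "len T'' - sum d (insert j J) \<le> len T - sum d I + \<delta>"
    using J(1,7) T''(2) zy \<open>j \<notin> J\<close> by simp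
  ultimately show ?case
    using J T'' by (intro exI[of _ T''] exI[of _ "insert j J"]) auto
qed

text \<open>The points are added one at a time. Every addition pays for its chain with newly charged
  sets, up to one edge of length at most \<delta>.\<close>

lemma network_through_finite:
  assumes "finite F" "F \<noteq> {}" "F \<subseteq> K"
  shows "\<exists>T. mesh_le \<delta> T \<and> F \<subseteq> verts T \<and> len T \<le> M + card F * \<delta>"
proof -
  \<comment> \<open>\<open>I\<close> collects the charged sets. At least one of them has to meet
    \<open>K\<close>, so that the next chain can start there.\<close>
  have "\<exists>T I. mesh_le \<delta> T \<and> F \<subseteq> verts T \<and> finite I \<and> (\<forall>i\<in>I. V i \<inter> verts T \<noteq> {}) \<and>
      (\<exists>i\<in>I. V i \<inter> K \<noteq> {}) \<and> len T \<le> sum d I + card F * \<delta>"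
    using assms
  proof (induction F rule: finite_ne_induct)
    case (singleton x)
    then obtain i where i: "x \<in> V i" using cover by auto
    then have "0 \<le> \<delta>" using d_nonneg[of i] d_le[of i] by simp
    then show ?case
      using i singleton d_nonneg[of i] by (intro exI[of _ "Point x"] exI[of _ "{i}"]) auto
  next
    case (insert y F)
    then obtain T I where T: "mesh_le \<delta> T" "F \<subseteq> verts T" "finite I"
      "\<forall>i\<in>I. V i \<inter> verts T \<noteq> {}" "\<exists>i\<in>I. V i \<inter> K \<noteq> {}" "len T \<le> sum d I + card F * \<delta>"
      by auto
    from T(5) obtain i x where "i \<in> I" "x \<in> V i" "x \<in> K" by auto
    from reachable[OF this, of y] obtain n j where nj: "j \<in> (adj ^^ n) `` I" "y \<in> V j"
      using insert.prems by blast
    define m where "m = (LEAST n. j \<in> (adj ^^ n) `` I)"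
    have m: "j \<in> (adj ^^ m) `` I" "\<And>k. k < m \<Longrightarrow> j \<notin> (adj ^^ k) `` I"
      unfolding m_def using LeastI[of "\<lambda>n. j \<in> (adj ^^ n) `` I", OF nj(1)] not_less_Least by blast+
    from extend_along_chain[OF _ T(3,1) m nj(2)] T(4) obtain T' J where
      T': "finite J" "I \<subseteq> J" "mesh_le \<delta> T'" "insert y (verts T) \<subseteq> verts T'"
      "\<forall>i\<in>J. V i \<inter> verts T' \<noteq> {}" "len T' - sum d J \<le> len T - sum d I + \<delta>" by blast
    have "len T' \<le> sum d J + card (insert y F) * \<delta>"
      using T'(6) T(6) insert.hyps by (simp add: algebra_simps)
    then show ?case
      using T' T by (intro exI[of _ T'] exI[of _ J]) auto
  qed
  then show ?thesis using sum_d_le by (meson add_right_mono order.trans)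
qed

end

lemma network_in_connected:
  fixes K :: "'a::metric_space set"
  assumes K: "connected K" "hausdorff1 K \<le> ennreal H" "0 \<le> H"
    and F: "finite F" "F \<noteq> {}" "F \<subseteq> K" and pos: "0 < \<epsilon>" "0 < \<delta>"
  shows "\<exists>T. mesh_le \<delta> T \<and> F \<subseteq> verts T \<and> len T \<le> H + \<epsilon>"
proof -
  have card: "real (card F) > 0" using F by (simp add: card_gt_0_iff)
  \<comment> \<open>The error splits into three parts of size \<epsilon>/3: near-optimality of the
    cover, its enlargement to open sets, and the \<open>card F\<close> uncharged edges of length at
    most \<open>r\<close>.\<close>
  define r where "r = min \<delta> (\<epsilon> / (3 * card F))"
  have r: "0 < r" "r \<le> \<delta>" "card F * r \<le> \<epsilon> / 3"
    using pos card by (auto simp: r_def min_def field_simps)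
  have "hausdorff1_pre (r/2) K \<le> ennreal H"
    using order.trans[OF SUP_upper[of "r/2" "{0<..}" "\<lambda>d. hausdorff1_pre d K"] K(2)[unfolded hausdorff1_def]] r(1) by simp
  also have "\<dots> < ennreal (H + \<epsilon>/3)"
    using K(3) pos by (simp add: ennreal_lessI)
  finally obtain U where U: "K \<subseteq> (\<Union>i. U i)" "\<And>i. bounded (U i)" "\<And>i. diameter (U i) \<le> r/2"
    "(\<Sum>i. ennreal (diameter (U i))) < ennreal (H + \<epsilon>/3)"
    unfolding hausdorff1_pre_def by (auto simp: INF_less_iff)
  define c where "c = min (r/2) (\<epsilon>/6)"
  have c: "0 < c" "c \<le> r/2" "c \<le> \<epsilon>/6" using r pos by (auto simp: c_def)
  \<comment> \<open>The enlargements add up to \<open>2 * c\<close>, at most \<epsilon>/3. Each adds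
    at most \<open>r/2\<close> to a diameter that is at most \<open>r/2\<close>.\<close>
  define e where "e i = c * (1/2) ^ Suc i" for i :: nat
  have e: "0 < e i" "2 * e i \<le> c" for i
    using c(1) by (auto simp: e_def mult_le_cancel_left1 power_le_one)
  have sum_e: "sum (\<lambda>i. 2 * e i) J \<le> \<epsilon> / 3" if "finite J" for J
  proof -
    have "(\<lambda>i. 2 * c * (1/2) ^ Suc i) sums (2 * c * 1)"
      by (intro sums_mult power_half_series)
    then have s: "(\<lambda>i. 2 * e i) sums (2 * c)" by (simp add: e_def mult.assoc)
    have "sum (\<lambda>i. 2 * e i) J \<le> (\<Sum>i. 2 * e i)"
      using e less_imp_le[OF e(1)] s that by (intro sum_le_suminf) (auto simp: sums_iff)
    then show ?thesis using s c by (simp add: sums_iff)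
  qed
  define V where "V i = (\<Union>x\<in>U i. ball x (e i))" for i
  define d where "d i = diameter (U i) + 2 * e i" for i
  interpret small_cover V d K r "H + 2 * \<epsilon> / 3"
  proof
    show "open (V i)" for i unfolding V_def by auto
    have "U i \<subseteq> V i" for i using e(1)[of i] unfolding V_def by force
    then have "(\<Union>i. U i) \<subseteq> (\<Union>i. V i)" by (intro UN_mono) simp_all
    then show "K \<subseteq> (\<Union>i. V i)" by (rule order.trans[OF U(1)])
    show "dist x y \<le> d i" if xy: "x \<in> V i" "y \<in> V i" for i x y
    proof -
      obtain x' y' where *: "x' \<in> U i" "y' \<in> U i" "dist x' x < e i" "dist y' y < e i"
        using xy unfolding V_def by auto
      have "dist x' y' \<le> diameter (U i)"
        using U(2) * by (intro diameter_bounded_bound) auto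
      moreover have "dist x y \<le> dist x' x + dist x' y' + dist y' y"
        using dist_triangle[of x y x'] dist_triangle[of x' y y'] by (simp add: dist_commute)
      ultimately show ?thesis using * unfolding d_def by simp
    qed
    show "0 \<le> d i" for i using diameter_ge_0[OF U(2)] e(1)[of i] unfolding d_def by (simp add: add_nonneg_nonneg less_imp_le)
    show "d i \<le> r" for i using U(3)[of i] e[of i] c unfolding d_def by simp
    show "sum d J \<le> H + 2 * \<epsilon> / 3" if J: "finite J" for J
    proof -
      have "ennreal (\<Sum>i\<in>J. diameter (U i)) = (\<Sum>i\<in>J. ennreal (diameter (U i)))"
        using diameter_ge_0[OF U(2)] by simp
      also have "\<dots> \<le> (\<Sum>i. ennreal (diameter (U i)))"
        using J by (intro sum_le_suminf) auto
      also have "\<dots> \<le> ennreal (H + \<epsilon>/3)" using U(4) by simp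
      finally have "(\<Sum>i\<in>J. diameter (U i)) \<le> H + \<epsilon>/3"
        using K(3) pos by (simp add: ennreal_le_iff del: ennreal_plus)
      then show ?thesis using sum_e[OF J] unfolding d_def by (simp add: sum.distrib)
    qed
    show "connected K" by fact
  qed
  obtain T where "mesh_le r T" "F \<subseteq> verts T" "len T \<le> H + 2 * \<epsilon> / 3 + card F * r"
    using network_through_finite[OF F] by blast
  then show ?thesis using r mesh_le_mono by (intro exI[of _ T]) auto
qed

subsection \<open>Coarsening a network\<close>

text \<open>The whiskers form a cross parallel to the axes. A unit vector has a coordinate of
  absolute value at least 1/2, so one of the four arms advances by \<open>h / 2\<close> in its
  direction.\<close>

lemma add_whisker:
  fixes D :: "(real^2) network"
  assumes "z \<in> verts D" "0 \<le> h"
  obtains D' where "origin D' = origin D" "verts D \<subseteq> verts D'" "len D' = len D + 4 * h"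
    "\<And>u. norm u = 1 \<Longrightarrow> \<exists>y\<in>verts D'. dist z y = h \<and> u \<bullet> (y - z) \<ge> h / 2"
proof -
  define e1 e2 :: "real^2" where "e1 = axis 1 1" and "e2 = axis 2 1"
  have n: "norm e1 = 1" "norm e2 = 1" by (simp_all add: e1_def e2_def norm_axis_1)
  have ins: "\<exists>D'. origin D' = origin D0 \<and> verts D' = insert (z + w) (verts D0) \<and> len D' = len D0 + h"
    if "z \<in> verts D0" "norm w = h" for D0 w
    using network_insert[OF that(1), of "z + w"] that(2) by (auto simp: dist_norm)
  obtain D1 where D1: "origin D1 = origin D" "verts D1 = insert (z + h *\<^sub>R e1) (verts D)" "len D1 = len D + h"
    using ins[of D "h *\<^sub>R e1"] assms n by auto
  obtain D2 where D2: "origin D2 = origin D" "verts D2 = insert (z + - h *\<^sub>R e1) (verts D1)" "len D2 = len D + 2 * h"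
    using ins[of D1 "- h *\<^sub>R e1"] assms n D1 by auto
  obtain D3 where D3: "origin D3 = origin D" "verts D3 = insert (z + h *\<^sub>R e2) (verts D2)" "len D3 = len D + 3 * h"
    using ins[of D2 "h *\<^sub>R e2"] assms n D1 D2 by auto
  obtain D4 where D4: "origin D4 = origin D" "verts D4 = insert (z + - h *\<^sub>R e2) (verts D3)" "len D4 = len D + 4 * h"
    using ins[of D3 "- h *\<^sub>R e2"] assms n D1 D2 D3 by auto
  show thesis
  proof (rule that[of D4])
    fix u :: "real^2" assume u: "norm u = 1"
    have ue: "u \<bullet> e1 = u $ 1" "u \<bullet> e2 = u $ 2"
      by (simp_all add: e1_def e2_def inner_axis)
    have "(u $ 1)\<^sup>2 + (u $ 2)\<^sup>2 = 1"
      using u by (simp add: norm_eq_1 inner_vec_def sum_2 power2_eq_square)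
    then have "\<bar>u $ 1\<bar> \<ge> 1/2 \<or> \<bar>u $ 2\<bar> \<ge> 1/2"
      using abs_le_square_iff[of "u$1" "1/2"] abs_le_square_iff[of "u$2" "1/2"]
      by (auto simp: power2_eq_square)
    then consider "u \<bullet> e1 \<ge> 1/2" | "- (u \<bullet> e1) \<ge> 1/2" | "u \<bullet> e2 \<ge> 1/2" | "- (u \<bullet> e2) \<ge> 1/2"
      unfolding ue by linarith
    then obtain w where w: "z + h *\<^sub>R w \<in> verts D4" "norm w = 1" "u \<bullet> w \<ge> 1/2"
    proof cases
      case 1 then show ?thesis using that[of e1] D1 D2 D3 D4 n by auto
    next
      case 2 then show ?thesis using that[of "- e1"] D1 D2 D3 D4 n by auto
    next
      case 3 then show ?thesis using that[of e2] D1 D2 D3 D4 n by auto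
    next
      case 4 then show ?thesis using that[of "- e2"] D1 D2 D3 D4 n by auto
    qed
    show "\<exists>y\<in>verts D4. dist z y = h \<and> u \<bullet> (y - z) \<ge> h / 2"
      using w assms mult_left_mono[OF w(3) assms(2)] by (intro bexI[of _ "z + h *\<^sub>R w"]) (auto simp: dist_norm)
  qed (use D1 D2 D3 D4 in auto)
qed

text \<open>Compare with the reflection of \<open>b\<close> in the hyperplane orthogonal to \<open>u\<close>.\<close>

lemma inner_ge_reflected:
  fixes a b u :: "'a::real_inner"
  assumes "norm u = 1"
  shows "norm a * norm b + a \<bullet> b \<ge> 2 * (u \<bullet> a) * (u \<bullet> b)"
proof -
  define b' where "b' = b - (2 * (u \<bullet> b)) *\<^sub>R u"
  have uu: "u \<bullet> u = 1" using assms by (simp add: norm_eq_1)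
  have "b' \<bullet> b' = b \<bullet> b"
    using uu by (simp add: b'_def inner_diff_left inner_diff_right inner_commute algebra_simps)
  then have "norm b' = norm b" by (simp add: norm_eq_sqrt_inner)
  moreover have "- (a \<bullet> b') \<le> norm a * norm b'"
    using norm_cauchy_schwarz[of "- a" b'] by simp
  ultimately show ?thesis
    by (simp add: b'_def inner_diff_right inner_commute algebra_simps)
qed

text \<open>The parameter \<open>a\<close> balances the terms of
  \<open>sqrt(\<eta> x) <= a \<eta> + x / a\<close>. The constant 122 is 11^2 + 1: auxiliary points
  lie within 11 \<eta>, and one more \<open>\<eta>\<^sup>2\<close> absorbs the excess of
  \<open>(s + \<delta>)\<^sup>2\<close> over \<open>s\<^sup>2\<close>.\<close>

locale coarsening =
  fixes s \<delta> \<eta> a :: real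
  assumes eta: "0 < \<eta>" "122 * \<eta> \<le> s" and a: "0 < a"
    and delta: "0 \<le> \<delta>" "2 * s * \<delta> + \<delta>\<^sup>2 \<le> \<eta>\<^sup>2"
begin

lemma s_pos: "0 < s" using eta by linarith

text \<open>Up to the factor 16, the cost of whiskers at a piece without excess length.\<close>

definition \<beta> :: real where "\<beta> = a * \<eta> + 122 * \<eta>\<^sup>2 / s"

text \<open>All points near \<open>v\<close> are considered, not just those of a given set to be
  covered; so the coarsening does not depend on that set.\<close>

definition good :: "real^2 \<Rightarrow> (real^2) set \<Rightarrow> bool" where
  "good v W \<longleftrightarrow> (\<forall>e. dist e v \<le> s + \<delta> \<longrightarrow> (\<exists>w\<in>W. dist e w \<le> s))"

lemma good_mono: "good v W \<Longrightarrow> W \<subseteq> W' \<Longrightarrow> good v W'"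
  unfolding good_def by blast

text \<open>Here \<open>p\<close> bounds the length of a tree containing \<open>r\<close>, \<open>q\<close> and \<open>v\<close>, so \<open>p - dist r q\<close> is
  what is saved by replacing this tree by the segment from \<open>r\<close> to \<open>q\<close>.\<close>

lemma flat_piece:
  fixes r q v u :: "real^2"
  assumes piece: "dist r v + dist v q + dist r q \<le> 2 * p" "p \<le> 3 * \<eta>" and u: "norm u = 1"
    and w: "w = min (3 * \<eta>) (a * \<eta> + (p - dist r q) / a)"
  shows "u \<bullet> (r - v) \<ge> - w \<or> u \<bullet> (q - v) \<ge> - w"
proof (rule ccontr)
  assume contra: "\<not> ?thesis"
  define A B where "A = r - v" and "B = q - v"
  have AB: "norm A = dist r v" "norm B = dist v q" "norm (A - B) = dist r q"
    by (simp_all add: A_def B_def dist_norm norm_minus_commute)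
  define x where "x = p - dist r q"
  have x: "norm A + norm B - norm (A - B) \<le> 2 * x" using piece AB by (simp add: x_def)
  have x0: "0 \<le> x" using x norm_triangle_ineq4[of A B] by simp
  \<comment> \<open>This excludes the first alternative of the minimum \<open>w\<close>.\<close>
  have "norm A \<le> 3 * \<eta>"
    using piece AB dist_triangle[of r v q] by (simp add: dist_commute) 
  then have "u \<bullet> A \<ge> - (3 * \<eta>)"
    using norm_cauchy_schwarz[of "- u" A] u by simp
  then have w': "w = a * \<eta> + x / a"
    using contra w x_def by (auto simp: A_def min_def split: if_splits)
  have w0: "0 \<le> w" using w' a eta x0 by simp
  \<comment> \<open>Arithmetic-geometric mean inequality:
    \<open>4 * (\<eta> * x) \<le> w\<^sup>2\<close>. The reflection bound and the factorization
    below give \<open>4 * w\<^sup>2 < 12 * (\<eta> * x)\<close>, a contradiction.\<close>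
  have eq: "w\<^sup>2 - 4 * (\<eta> * x) = (a * \<eta> - x / a)\<^sup>2"
    using a by (simp add: w' power2_eq_square field_simps)
  have "0 \<le> w\<^sup>2 - 4 * (\<eta> * x)" unfolding eq by (rule zero_le_power2)
  then have wx: "4 * (\<eta> * x) \<le> w\<^sup>2" by simp
  have "w * w < (- (u \<bullet> A)) * (- (u \<bullet> B))"
    using contra w0 by (intro mult_strict_mono') (auto simp: A_def B_def)
  then have P: "w\<^sup>2 < (u \<bullet> A) * (u \<bullet> B)" by (simp add: power2_eq_square)
  have Q: "norm A * norm B + A \<bullet> B \<ge> 2 * ((u \<bullet> A) * (u \<bullet> B))"
    using inner_ge_reflected[OF u, of A B] by (simp add: mult.assoc)
  have "2 * (norm A * norm B + A \<bullet> B) = (norm A + norm B - norm (A - B)) * (norm A + norm B + norm (A - B))"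
  proof -
    have "(norm (A - B))\<^sup>2 = (norm A)\<^sup>2 + (norm B)\<^sup>2 - 2 * (A \<bullet> B)"
      by (simp add: power2_norm_eq_inner inner_diff_left inner_diff_right inner_commute)
    then show ?thesis by (simp add: power2_eq_square algebra_simps)
  qed
  also have "\<dots> \<le> (2 * x) * (6 * \<eta>)"
    using x x0 piece AB by (intro mult_mono) auto
  also have "\<dots> = 12 * (\<eta> * x)" by simp
  finally have "2 * (norm A * norm B + A \<bullet> B) \<le> 12 * (\<eta> * x)" .
  moreover have "0 \<le> \<eta> * x" using eta x0 by simp
  moreover have "False" if "2 * m \<le> 12 * k" "0 \<le> k" "4 * k \<le> i" "i < j" "2 * j \<le> m" for m k i j :: real
    using that by linarith
  ultimately show False using wx P Q by blast
qed

text \<open>Moving from \<open>v\<close> towards \<open>e\<close> by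
  \<open>122 * \<eta>\<^sup>2 / s\<close> lowers the squared distance by
  \<open>122 * \<eta>\<^sup>2\<close> if \<open>e\<close> is at least \<open>s / 2\<close> away,
  while the sideways error is at most \<open>(11 * \<eta>)\<^sup>2\<close>. For nearer
  \<open>e\<close> the triangle inequality suffices.\<close>

lemma whisker_good:
  fixes v :: "real^2"
  assumes W: "\<And>u. norm u = 1 \<Longrightarrow> \<exists>y\<in>W. dist y v \<le> 11 * \<eta> \<and> u \<bullet> (y - v) \<ge> 122 * \<eta>\<^sup>2 / s"
  shows "good v W"
  unfolding good_def
proof (intro allI impI)
  fix e assume e: "dist e v \<le> s + \<delta>"
  define t where "t = dist e v"
  define u where "u = (if e = v then axis 1 1 else (1 / t) *\<^sub>R (e - v))"
  have u: "norm u = 1" "e - v = t *\<^sub>R u"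
    by (auto simp: u_def t_def dist_norm norm_axis_1)
  obtain y where y: "y \<in> W" "dist y v \<le> 11 * \<eta>" "u \<bullet> (y - v) \<ge> 122 * \<eta>\<^sup>2 / s"
    using W u by blast
  have "dist e y \<le> s"
  proof (cases "t < s / 2")
    case True
    then show ?thesis
      using y dist_triangle[of e y v] eta unfolding t_def by (simp add: dist_commute)
  next
    case False
    have "(dist e y)\<^sup>2 = (norm ((e - v) - (y - v)))\<^sup>2" by (simp add: dist_norm)
    also have "\<dots> = t\<^sup>2 - 2 * t * (u \<bullet> (y - v)) + (dist y v)\<^sup>2"
    proof -
      have "(norm (t *\<^sub>R u - w))\<^sup>2 = t\<^sup>2 * (u \<bullet> u) - 2 * t * (u \<bullet> w) + (norm w)\<^sup>2" for w
        by (simp only: power2_norm_eq_inner)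
           (simp add: inner_diff_left inner_diff_right inner_commute power2_eq_square algebra_simps)
      then show ?thesis using u(1) unfolding u(2) dist_norm by (simp add: norm_eq_1)
    qed
    also have "\<dots> \<le> (s + \<delta>)\<^sup>2 - 122 * \<eta>\<^sup>2 + (11 * \<eta>)\<^sup>2"
    proof -
      have "t\<^sup>2 \<le> (s + \<delta>)\<^sup>2" using e by (intro power_mono) (auto simp: t_def)
      moreover have "(dist y v)\<^sup>2 \<le> (11 * \<eta>)\<^sup>2" using y by (intro power_mono) auto
      moreover have "s * (122 * \<eta>\<^sup>2 / s) \<le> 2 * t * (u \<bullet> (y - v))"
        using False y s_pos by (intro mult_mono) auto
      ultimately show ?thesis using s_pos by simp
    qed
    also have "\<dots> \<le> s\<^sup>2" using delta by (simp add: power2_eq_square algebra_simps)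
    finally have "(dist e y)\<^sup>2 \<le> s\<^sup>2" .
    then show ?thesis by (rule power2_le_imp_le) (rule less_imp_le[OF s_pos])
  qed
  then show "\<exists>w\<in>W. dist e w \<le> s" using y by blast
qed

lemma whiskers_cover_piece:
  fixes D :: "(real^2) network"
  assumes D: "r \<in> verts D" "q \<in> verts D" and p: "dist r q \<le> p" "p \<le> 3 * \<eta>"
  obtains D' where "origin D' = origin D" "verts D \<subseteq> verts D'"
    "len D' \<le> len D + 16 * (\<beta> + (p - dist r q) / a)"
    "\<And>v. dist r v + dist v q + dist r q \<le> 2 * p \<Longrightarrow> good v (verts D')"
proof -
  define w where "w = min (3 * \<eta>) (a * \<eta> + (p - dist r q) / a)"
  define g where "g = 122 * \<eta>\<^sup>2 / s"
  \<comment> \<open>A whisker advances by \<open>h / 2 = w + g\<close>: \<open>w\<close> makes up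
    for the end point lying behind \<open>v\<close>, and \<open>g\<close> is left over. Since
    \<open>h\<close> is at most 8 \<eta> and the end points are within 3 \<eta> of \<open>v\<close>,
    the total distance is at most 11 \<eta>.\<close>
  define h where "h = 2 * (w + g)"
  have w: "0 \<le> w" "w \<le> 3 * \<eta>" "w \<le> a * \<eta> + (p - dist r q) / a" using eta a p by (auto simp: w_def)
  have "122 * \<eta> * \<eta> \<le> s * \<eta>" using eta by (intro mult_right_mono) auto
  then have g: "0 \<le> g" "g \<le> \<eta>" using s_pos by (auto simp: g_def field_simps power2_eq_square)
  have h: "0 \<le> h" using w g by (simp add: h_def)
  obtain D1 where D1: "origin D1 = origin D" "verts D \<subseteq> verts D1" "len D1 = len D + 4 * h"
    "\<And>u. norm u = 1 \<Longrightarrow> \<exists>y\<in>verts D1. dist r y = h \<and> u \<bullet> (y - r) \<ge> h / 2"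
    using add_whisker[OF D(1) h] by blast
  have "q \<in> verts D1" using D1(2) D(2) by blast
  then obtain D2 where D2: "origin D2 = origin D" "verts D1 \<subseteq> verts D2" "len D2 = len D + 8 * h"
    "\<And>u. norm u = 1 \<Longrightarrow> \<exists>y\<in>verts D2. dist q y = h \<and> u \<bullet> (y - q) \<ge> h / 2"
    using add_whisker[of q D1 h] h D1(1,3) by (smt (verit))
  show thesis
  proof (rule that[of D2])
    show "len D2 \<le> len D + 16 * (\<beta> + (p - dist r q) / a)"
      using D2(3) w(3) unfolding h_def \<beta>_def g_def[symmetric] distrib_left by linarith
    fix v assume v: "dist r v + dist v q + dist r q \<le> 2 * p"
    have near: "dist r v \<le> 3 * \<eta>" "dist q v \<le> 3 * \<eta>"
      using v p dist_triangle[of r v q] dist_triangle[of q v r] by (auto simp: dist_commute)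
    show "good v (verts D2)"
    proof (rule whisker_good)
      fix u :: "real^2" assume u: "norm u = 1"
      obtain z where z: "z \<in> {r, q}" "u \<bullet> (z - v) \<ge> - w"
        using flat_piece[OF v p(2) u w_def] by auto
      then obtain y where y: "y \<in> verts D2" "dist z y = h" "u \<bullet> (y - z) \<ge> h / 2"
        using D1(4)[OF u] D2(2) D2(4)[OF u] by blast
      have "dist y v \<le> h + 3 * \<eta>"
        using dist_triangle[of y v z] near z(1) y(2) by (auto simp: dist_commute)
      moreover have "u \<bullet> (y - v) = u \<bullet> (y - z) + u \<bullet> (z - v)"
        by (simp add: inner_diff_right)
      ultimately show "\<exists>y\<in>verts D2. dist y v \<le> 11 * \<eta> \<and> u \<bullet> (y - v) \<ge> 122 * \<eta>\<^sup>2 / s"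
        using y z(2) w g by (intro bexI[of _ y]) (auto simp: h_def g_def)
    qed
  qed (use D1 D2 in auto)
qed

text \<open>\<open>C\<close> is a coarse version of a network of length \<open>l\<close> with vertices \<open>V\<close>, and \<open>D\<close> is \<open>C\<close> with
  whiskers. A part of length \<open>p\<close> around the origin \<open>r\<close>, attached to \<open>C\<close> at \<open>origin C\<close> only, is still
  pending. Every finished piece costs whiskers of length \<open>16 * (\<beta> + x / a)\<close>, where \<open>x\<close> is the length
  that \<open>C\<close> saves on it; the number of finished pieces is at most \<open>4 * (l - p) / \<eta> - j\<close>.\<close>

definition coarsened ::
  "(real^2) set \<Rightarrow> real^2 \<Rightarrow> real \<Rightarrow> real \<Rightarrow> real \<Rightarrow> (real^2) network \<Rightarrow> (real^2) network \<Rightarrow> bool" where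
  "coarsened V r l p j C D \<longleftrightarrow>
     origin D = origin C \<and> mesh_le (3 * \<eta>) C \<and> dist r (origin C) \<le> p \<and> len C \<le> l - p \<and>
     len D \<le> len C + 16 * ((4 * (l - p) / \<eta> - j) * \<beta> + (l - p - len C) / a) \<and>
     (\<forall>v\<in>V. (good v (verts D) \<and> (\<exists>c\<in>verts C. dist v c \<le> 3 * \<eta>)) \<or>
            dist r v + dist v (origin C) + dist r (origin C) \<le> 2 * p)"

section \<open>Operations on partially coarsened networks\<close>

text \<open>The edge from the new root \<open>r'\<close> to \<open>r\<close> joins the pending part;
  \<open>l - p\<close> and hence all bounds on \<open>C\<close> and \<open>D\<close> are
  unchanged.\<close>

lemma coarsened_shift:
  assumes "coarsened V r l p j C D"
  shows "coarsened V r' (l + dist r' r) (p + dist r' r) j C D"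
proof -
  have "dist r' (origin C) \<le> dist r (origin C) + dist r' r" "dist r' v \<le> dist r v + dist r' r" for v
    using dist_triangle[of r' "origin C" r] dist_triangle[of r' v r] by auto
  then show ?thesis
    using assms unfolding coarsened_def by (auto simp: algebra_simps) (smt (verit, ccfv_SIG))+
qed

text \<open>A short branch at \<open>r\<close> becomes pending as a whole; again
  \<open>l - p\<close> is unchanged.\<close>

lemma coarsened_merge:
  assumes "coarsened V r l p j C D" "\<And>v. v \<in> V' \<Longrightarrow> dist r v \<le> p'" "0 \<le> p'"
  shows "coarsened (V \<union> V') r (l + p') (p + p') j C D"
proof -
  have C: "origin D = origin C" "mesh_le (3 * \<eta>) C" "dist r (origin C) \<le> p" "len C \<le> l - p" 
     "len D \<le> len C + 16 * ((4 * (l - p) / \<eta> - j) * \<beta> + (l - p - len C) / a)"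
     "\<And>v. v \<in> V \<Longrightarrow> (good v (verts D) \<and> (\<exists>c\<in>verts C. dist v c \<le> 3 * \<eta>)) \<or>
            dist r v + dist v (origin C) + dist r (origin C) \<le> 2 * p"
    using assms(1) unfolding coarsened_def by auto
  have "dist r v + dist v (origin C) + dist r (origin C) \<le> 2 * (p + p')" if "v \<in> V'" for v
    using assms(2)[OF that] dist_triangle[of v "origin C" r] C(3) by (simp add: dist_commute)
  moreover have "l + p' - (p + p') = l - p" by simp
  moreover have "good v (verts D) \<and> (\<exists>c\<in>verts C. dist v c \<le> 3 * \<eta>) \<or>
      dist r v + dist v (origin C) + dist r (origin C) \<le> 2 * (p + p')" if "v \<in> V" for v
    using C(6)[OF that] assms(3) by auto
  ultimately show ?thesis
    using C(1-5) assms(3) unfolding coarsened_def by auto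
qed

text \<open>The pending part becomes a single edge from \<open>r\<close> to \<open>origin C\<close>,
  with whiskers at both ends. In the count \<open>j\<close>, the new piece costs 1 and its length
  earns \<open>4 * p / \<eta>\<close>.\<close>

lemma coarsened_close:
  assumes "coarsened V r l p j C D" "p \<le> 3 * \<eta>"
  obtains C' D' where "coarsened V r l 0 (j - 1 + 4 * p / \<eta>) C' D'" "origin C' = r"
    "\<And>v. v \<in> V \<Longrightarrow> good v (verts D') \<and> (\<exists>c\<in>verts C'. dist v c \<le> 3 * \<eta>)"
proof -
  have C: "origin D = origin C" "mesh_le (3 * \<eta>) C" "dist r (origin C) \<le> p" "len C \<le> l - p" 
     "len D \<le> len C + 16 * ((4 * (l - p) / \<eta> - j) * \<beta> + (l - p - len C) / a)"
     "\<And>v. v \<in> V \<Longrightarrow> (good v (verts D) \<and> (\<exists>c\<in>verts C. dist v c \<le> 3 * \<eta>)) \<or>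
            dist r v + dist v (origin C) + dist r (origin C) \<le> 2 * p"
    using assms(1) unfolding coarsened_def by auto
  define C' where "C' = Graft (Point r) C"
  define D0 where "D0 = Graft (Point r) D"
  have "r \<in> verts D0" "origin C \<in> verts D0"
    using origin_in_verts[of D] C(1) by (auto simp: D0_def)
  from whiskers_cover_piece[OF this C(3) assms(2)] obtain D' where
    D': "origin D' = origin D0" "verts D0 \<subseteq> verts D'"
    "len D' \<le> len D0 + 16 * (\<beta> + (p - dist r (origin C)) / a)"
    "\<And>v. dist r v + dist v (origin C) + dist r (origin C) \<le> 2 * p \<Longrightarrow> good v (verts D')"
    by blast
  have "len D' \<le> len C' + 16 * ((4 * (l - 0) / \<eta> - (j - 1 + 4 * p / \<eta>)) * \<beta> + (l - 0 - len C') / a)"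
  proof -
    have "(4 * (l - p) / \<eta> - j) * \<beta> + \<beta> = (4 * (l - 0) / \<eta> - (j - 1 + 4 * p / \<eta>)) * \<beta>"
      by (simp add: algebra_simps diff_divide_distrib)
    moreover have "(l - p - len C) / a + (p - dist r (origin C)) / a = (l - 0 - len C') / a"
      by (simp add: C'_def flip: add_divide_distrib)
    moreover have "len D' \<le> len C' + 16 * (((4 * (l - p) / \<eta> - j) * \<beta> + \<beta>) +
        ((l - p - len C) / a + (p - dist r (origin C)) / a))"
      using D'(3) C(1,5) unfolding D0_def C'_def len.simps origin.simps distrib_left C(1) by linarith
    ultimately show ?thesis by simp
  qed
  moreover have cov: "good v (verts D') \<and> (\<exists>c\<in>verts C'. dist v c \<le> 3 * \<eta>)" if "v \<in> V" for v
  proof (cases "dist r v + dist v (origin C) + dist r (origin C) \<le> 2 * p")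
    case True
    then have "dist v r \<le> 3 * \<eta>"
      using assms(2) dist_triangle[of r v "origin C"] by (simp add: dist_commute)
    then show ?thesis using D'(4)[OF True] by (auto simp: C'_def)
  next
    case False
    then have "good v (verts D)" "\<exists>c\<in>verts C. dist v c \<le> 3 * \<eta>" using C(6)[OF that] by auto
    moreover have "verts D \<subseteq> verts D'" using D'(2) by (auto simp: D0_def)
    ultimately show ?thesis using good_mono by (auto simp: C'_def)
  qed
  ultimately have "coarsened V r l 0 (j - 1 + 4 * p / \<eta>) C' D'"
    using C D'(1) assms(2) unfolding coarsened_def by (auto simp: C'_def D0_def)
  then show thesis using that cov by (simp add: C'_def)
qed

text \<open>The first piece of a branch has only one boundary point; it collapses to the degenerate
  segment at \<open>r\<close>, and its whole length \<open>p\<close> is excess.\<close>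

lemma coarsened_close_ball:
  assumes "\<And>v. v \<in> V \<Longrightarrow> dist r v \<le> p" "0 \<le> p" "p \<le> 3 * \<eta>"
  obtains C D where "coarsened V r p 0 (4 * p / \<eta> - 1) C D" "origin C = r"
    "\<And>v. v \<in> V \<Longrightarrow> good v (verts D) \<and> (\<exists>c\<in>verts C. dist v c \<le> 3 * \<eta>)"
proof -
  have "coarsened {} r 0 0 0 (Point r) (Point r)"
    by (simp add: coarsened_def)
  from coarsened_merge[OF this assms(1,2)] have "coarsened V r p p 0 (Point r) (Point r)" by simp
  from coarsened_close[OF this assms(3)] that show thesis by auto
qed

text \<open>Both parts are closed and rooted at \<open>r\<close>, so the grafting edge has length 0
  and all bounds add up.\<close>

lemma coarsened_join:
  assumes "coarsened V1 r l1 0 j1 C1 D1" "origin C1 = r" "coarsened V2 r l2 0 j2 C2 D2" "origin C2 = r"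
  shows "coarsened (V1 \<union> V2) r (l1 + l2) 0 (j1 + j2) (Graft C1 C2) (Graft D1 D2)"
proof -
  have split: "16 * ((4 * (l1 + l2 - 0) / \<eta> - (j1 + j2)) * \<beta> + (l1 + l2 - 0 - (len C1 + len C2)) / a) =
    16 * ((4 * (l1 - 0) / \<eta> - j1) * \<beta> + (l1 - 0 - len C1) / a) +
    16 * ((4 * (l2 - 0) / \<eta> - j2) * \<beta> + (l2 - 0 - len C2) / a)"
    by (simp add: algebra_simps add_divide_distrib diff_divide_distrib)
  have good: "\<forall>v\<in>V1. good v (verts D1) \<and> (\<exists>c\<in>verts C1. dist v c \<le> 3 * \<eta>) \<or> v = r"
    "\<forall>v\<in>V2. good v (verts D2) \<and> (\<exists>c\<in>verts C2. dist v c \<le> 3 * \<eta>) \<or> v = r"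
    using assms unfolding coarsened_def by (auto simp: dist_commute)
  have "len (Graft D1 D2) \<le> len (Graft C1 C2) + 16 * ((4 * (l1 + l2 - 0) / \<eta> - (j1 + j2)) * \<beta> + (l1 + l2 - 0 - len (Graft C1 C2)) / a)"
    using assms split unfolding coarsened_def by simp
  moreover have "good v (verts (Graft D1 D2))" if "good v (verts D1) \<or> good v (verts D2)" for v
    using that good_mono[of v _ "verts (Graft D1 D2)"] by auto
  ultimately show ?thesis
    using assms good eta unfolding coarsened_def
    by (auto simp: dist_commute)
qed

lemma coarsened_weaken:
  assumes "coarsened V r l p j C D" "j' \<le> j"
  shows "coarsened V r l p j' C D"
proof -
  have "0 \<le> \<beta>" using a eta s_pos by (simp add: \<beta>_def)
  then have "(4 * (l - p) / \<eta> - j) * \<beta> \<le> (4 * (l - p) / \<eta> - j') * \<beta>"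
    using assms by (intro mult_right_mono) auto
  then show ?thesis using assms(1) unfolding coarsened_def by auto
qed

text \<open>The credit 2 reproduces itself. Where two unfinished branches meet, the pending part
  would get three boundary points, so both are closed at cost 1 each, leaving 1 + 1. Any other
  closing happens at length at least \<eta>, which earns 4.\<close>

lemma coarsening_step:
  assumes "mesh_le \<eta> T"
  shows "len T < \<eta> \<or> (\<exists>p<\<eta>. \<exists>C D. coarsened (verts T) (origin T) (len T) p 2 C D)"
  using assms
proof (induction T)
  case (Point x)
  then show ?case using eta by simp
next
  case (Graft S T)
  define r where "r = origin S"
  define e where "e = dist r (origin T)"
  have e: "0 \<le> e" "e \<le> \<eta>" using Graft.prems by (auto simp: e_def r_def)
  let ?V = "verts (Graft S T)"
  let ?l = "len (Graft S T)"
  have l: "?l = len S + (len T + e)" "?l = (len T + e) + len S" and V: "?V = verts S \<union> verts T" "?V = verts T \<union> verts S"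
    by (auto simp: e_def r_def)
  have origin: "origin (Graft S T) = r" by (simp add: r_def)
  have finish: ?case if c: "coarsened ?V r ?l p 2 C D" "p \<le> 3 * \<eta>" for p C D
  proof (cases "p < \<eta>")
    case True
    then show ?thesis using c origin by auto
  next
    case False
    then have "4 * p / \<eta> \<ge> 4" using eta by (simp add: field_simps)
    moreover obtain C' D' where "coarsened ?V r ?l 0 (2 - 1 + 4 * p / \<eta>) C' D'"
      using coarsened_close[OF c] by blast
    ultimately have "coarsened ?V r ?l 0 2 C' D'" by (elim coarsened_weaken) simp
    then show ?thesis using eta origin by auto
  qed
  have ballS: "dist r v \<le> len S" if "v \<in> verts S" for v
    using dist_origin_le_len[OF that] by (simp add: r_def)
  have ballT: "dist r v \<le> len T + e" if "v \<in> verts T" for v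
    using dist_origin_le_len[OF that] dist_triangle[of r v "origin T"] by (simp add: e_def)
  have "len S < \<eta> \<or> (\<exists>p<\<eta>. \<exists>C D. coarsened (verts S) r (len S) p 2 C D)"
       "len T < \<eta> \<or> (\<exists>p<\<eta>. \<exists>C D. coarsened (verts T) r (len T + e) (p + e) 2 C D)"
  proof -
    show "len S < \<eta> \<or> (\<exists>p<\<eta>. \<exists>C D. coarsened (verts S) r (len S) p 2 C D)"
      using Graft by (simp add: r_def)
    have "len T < \<eta> \<or> (\<exists>p<\<eta>. \<exists>C D. coarsened (verts T) (origin T) (len T) p 2 C D)"
      using Graft by simp
    then show "len T < \<eta> \<or> (\<exists>p<\<eta>. \<exists>C D. coarsened (verts T) r (len T + e) (p + e) 2 C D)"
      using coarsened_shift[of "verts T" "origin T" "len T" _ 2 _ _ r] unfolding e_def by blast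
  qed
  then consider
      (0) "len S < \<eta>" "len T < \<eta>" 
    | (1) p C D where "len S < \<eta>" "p < \<eta>" "coarsened (verts T) r (len T + e) (p + e) 2 C D"
    | (2) p C D where "len T < \<eta>" "p < \<eta>" "coarsened (verts S) r (len S) p 2 C D"
    | (3) p C D p' C' D' where "p < \<eta>" "coarsened (verts S) r (len S) p 2 C D"
          "p' < \<eta>" "coarsened (verts T) r (len T + e) (p' + e) 2 C' D'"
    by blast
  then show ?case
  proof cases
    case 0
    have *: "dist r v \<le> ?l" if "v \<in> ?V" for v
    proof -
      have "dist r v \<le> len S \<or> dist r v \<le> len T + e" using that ballS ballT by auto
      then show ?thesis using len_nonneg[of S] len_nonneg[of T] e(1) unfolding l by linarith
    qed
    have **: "?l \<le> 3 * \<eta>" using 0 e unfolding l by linarith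
    show ?thesis
    proof (cases "?l < \<eta>")
      case False
      then have "4 * ?l / \<eta> \<ge> 4" using eta by (simp add: field_simps)
      moreover obtain C D where "coarsened ?V r ?l 0 (4 * ?l / \<eta> - 1) C D"
        using coarsened_close_ball[OF * len_nonneg **] by blast
      ultimately have "coarsened ?V r ?l 0 2 C D" by (elim coarsened_weaken) linarith
      then show ?thesis using eta by (intro finish[of 0]) auto
    qed blast
  next
    case 1
    then have "coarsened ?V r ?l (p + e + len S) 2 C D"
      using coarsened_merge[OF 1(3) ballS] unfolding l(2) V(2) by simp
    then show ?thesis using 1 e by (intro finish) auto
  next
    case 2
    then have "coarsened ?V r ?l (p + (len T + e)) 2 C D"
      using coarsened_merge[OF 2(3) ballT] e unfolding l(1) V(1) by simp
    then show ?thesis using 2 e by (intro finish) auto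
  next
    case 3
    have p: "0 \<le> p" "0 \<le> p' + e" 
      using 3 unfolding coarsened_def by (meson order.trans zero_le_dist)+
    have p3: "p \<le> 3 * \<eta>" "p' + e \<le> 3 * \<eta>" using 3(1,3) e eta by linarith+
    obtain C1 D1 where 1: "coarsened (verts S) r (len S) 0 (2 - 1 + 4 * p / \<eta>) C1 D1" "origin C1 = r"
      using coarsened_close[OF 3(2)] p3(1) by blast
    obtain C2 D2 where 2: "coarsened (verts T) r (len T + e) 0 (2 - 1 + 4 * (p' + e) / \<eta>) C2 D2" "origin C2 = r"
      using coarsened_close[OF 3(4)] p3(2) by blast
    have "coarsened ?V r ?l 0 2 (Graft C1 C2) (Graft D1 D2)"
      using coarsened_join[OF 1 2] p eta unfolding l(1) V(1) by (elim coarsened_weaken) simp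
    then show ?thesis using eta by (intro finish[of 0]) auto
  qed
qed

lemma coarsening:
  assumes "mesh_le \<eta> T"
  obtains C D where "mesh_le (3 * \<eta>) C" "\<And>v. v \<in> verts T \<Longrightarrow> \<exists>c\<in>verts C. dist v c \<le> 3 * \<eta>"
    "\<And>v. v \<in> verts T \<Longrightarrow> good v (verts D)" "len C \<le> len T"
    "len D \<le> len C + 16 * ((4 * len T / \<eta> + 1) * \<beta> + (len T - len C) / a)"
proof -
  \<comment> \<open>The count -1 allows for a network shorter than \<eta>, closed as one piece; it
    becomes the \<open>+ 1\<close> in the bound.\<close>
  have "\<exists>C D. coarsened (verts T) (origin T) (len T) 0 (-1) C D \<and>
      (\<forall>v\<in>verts T. good v (verts D) \<and> (\<exists>c\<in>verts C. dist v c \<le> 3 * \<eta>))"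
    using coarsening_step[OF assms]
  proof (elim disjE exE conjE)
    assume "len T < \<eta>"
    then have l: "len T \<le> 3 * \<eta>" using eta by simp
    obtain C D where "coarsened (verts T) (origin T) (len T) 0 (4 * len T / \<eta> - 1) C D"
      "\<And>v. v \<in> verts T \<Longrightarrow> good v (verts D) \<and> (\<exists>c\<in>verts C. dist v c \<le> 3 * \<eta>)"
      by (rule coarsened_close_ball[of "verts T" "origin T" "len T"])
         (use dist_origin_le_len l in \<open>auto intro: that\<close>)
    moreover have "-1 \<le> 4 * len T / \<eta> - 1" using eta by simp
    ultimately show ?thesis using coarsened_weaken by blast
  next
    fix p C D assume p: "p < \<eta>" "coarsened (verts T) (origin T) (len T) p 2 C D"
    then have p0: "0 \<le> p" "p \<le> 3 * \<eta>"
      using eta zero_le_dist[of "origin T" "origin C"] unfolding coarsened_def by linarith+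
    obtain C' D' where "coarsened (verts T) (origin T) (len T) 0 (2 - 1 + 4 * p / \<eta>) C' D'"
      "\<And>v. v \<in> verts T \<Longrightarrow> good v (verts D') \<and> (\<exists>c\<in>verts C'. dist v c \<le> 3 * \<eta>)"
      by (rule coarsened_close[OF p(2) p0(2)]) (rule that)
    moreover have "-1 \<le> 2 - 1 + 4 * p / \<eta>" using divide_nonneg_pos[of "4 * p" \<eta>] eta p0 by simp
    ultimately show ?thesis using coarsened_weaken by blast
  qed
  then obtain C D where *: "coarsened (verts T) (origin T) (len T) 0 (-1) C D"
      "\<forall>v\<in>verts T. good v (verts D) \<and> (\<exists>c\<in>verts C. dist v c \<le> 3 * \<eta>)" by blast
  show thesis
    using *(2) *(1)[unfolded coarsened_def] by (intro that[of C D]) (simp_all add: add.commute)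
qed

end

subsection \<open>Covering at the exact distance\<close>

definition covers :: "(real^2) set \<Rightarrow> real \<Rightarrow> (real^2) network \<Rightarrow> bool" where
  "covers E t T \<longleftrightarrow> (\<forall>e\<in>E. \<exists>v\<in>verts T. dist e v \<le> t)"

text \<open>Compactness replaces \<open>K\<close> by finitely many of its points at the price of the
  excess \<delta>; a short network through these exists because \<open>K\<close> is
  connected.\<close>

lemma network_covering:
  assumes "compact E" "E \<noteq> {}" "connected K" "E \<subseteq> closed_nbhd K s" "hausdorff1 K \<le> ennreal H" "0 \<le> H"
    and "0 < \<epsilon>" "0 < \<delta>"
  shows "\<exists>T. mesh_le \<delta> T \<and> covers E (s + \<delta>) T \<and> len T \<le> H + \<epsilon>"
proof -
  have "E \<subseteq> (\<Union>k\<in>K. ball k (s + \<delta>))"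
  proof
    fix e assume "e \<in> E"
    then obtain k where "k \<in> K" "dist e k < s + \<delta>"
      using closed_nbhdD[of e K s "s + \<delta>"] assms by auto
    then show "e \<in> (\<Union>k\<in>K. ball k (s + \<delta>))" by (auto simp: dist_commute)
  qed
  then obtain F where F: "F \<subseteq> K" "finite F" "E \<subseteq> (\<Union>k\<in>F. ball k (s + \<delta>))"
    using compactE_image[OF assms(1), of K "\<lambda>k. ball k (s + \<delta>)"] by auto
  then have "F \<noteq> {}" using assms(2) by auto
  then obtain T where T: "mesh_le \<delta> T" "F \<subseteq> verts T" "len T \<le> H + \<epsilon>"
    using network_in_connected[OF assms(3,5,6) F(2) _ F(1) assms(7,8)] by blast
  have "covers E (s + \<delta>) T"
    unfolding covers_def
  proof
    fix e assume "e \<in> E"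
    then obtain k where "k \<in> F" "dist k e < s + \<delta>" using F(3) by auto
    then show "\<exists>v\<in>verts T. dist e v \<le> s + \<delta>"
      using T(2) by (intro bexI[of _ k]) (auto simp: dist_commute)
  qed
  then show ?thesis using T by blast
qed

definition relaxed_length :: "(real^2) set \<Rightarrow> real \<Rightarrow> real \<Rightarrow> real" where
  "relaxed_length E s \<delta> = Inf {len T | T. mesh_le \<delta> T \<and> covers E (s + \<delta>) T}"

lemma relaxed_length_le: "mesh_le \<delta> T \<Longrightarrow> covers E (s + \<delta>) T \<Longrightarrow> relaxed_length E s \<delta> \<le> len T"
  unfolding relaxed_length_def by (rule cInf_lower) (auto intro!: bdd_belowI[of _ 0])

text \<open>The relaxed lengths converge as \<open>\<delta>\<close> tends to 0. Hence a network that is almost optimal for a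
  \<open>\<delta>\<close> far below the scale \<open>\<eta>\<close> cannot be shortened much by coarsening it at scale \<open>\<eta>\<close>.\<close>

lemma covering_network_exists:
  assumes s: "0 < s" and \<epsilon>: "0 < \<epsilon>" and H: "0 \<le> H"
    and ex: "\<And>\<epsilon> \<delta>. 0 < \<epsilon> \<Longrightarrow> 0 < \<delta> \<Longrightarrow> \<exists>T. mesh_le \<delta> T \<and> covers E (s + \<delta>) T \<and> len T \<le> H + \<epsilon>"
  shows "\<exists>D. covers E s D \<and> len D \<le> H + \<epsilon>"
proof -
  let ?m = "relaxed_length E s"
  have m_le: "?m \<delta> \<le> H" if "0 < \<delta>" for \<delta>
  proof (rule field_le_epsilon)
    fix e :: real assume "0 < e"
    then show "?m \<delta> \<le> H + e" using ex[OF _ that] relaxed_length_le by (meson order.trans)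
  qed
  \<comment> \<open>Both constraints tighten as \<delta> decreases, so this supremum is the limit at
    0.\<close>
  define L where "L = (SUP \<delta>\<in>{0<..}. ?m \<delta>)"
  have bdd: "bdd_above (?m ` {0<..})" using m_le by (intro bdd_aboveI2[of _ _ H]) simp
  have L: "L \<le> H" unfolding L_def using m_le by (intro cSUP_least) auto
  \<comment> \<open>As \<open>len T < H + 1\<close> and \<open>\<eta> \<le> 1\<close>,
    \<open>N\<close> bounds \<open>16 * (4 * len T + \<eta>)\<close>. The parameters are chosen in
    the order \<open>a\<close>, \<open>e1\<close>, \<open>\<delta>0\<close>, \<open>\<eta>\<close>,
    \<open>\<delta>\<close>, and each of four error terms gets \<epsilon>/4.\<close>
  define N where "N = 16 * (4 * H + 9)"
  have N: "N > 0" using H by (simp add: N_def)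
  define a where "a = \<epsilon> / (4 * N)"
  have a: "0 < a" "N * a = \<epsilon> / 4" using \<epsilon> N by (auto simp: a_def)
  define e1 where "e1 = min 1 (min (\<epsilon> / 4) (\<epsilon> * a / 128))"
  have e1: "0 < e1" "e1 \<le> 1" "e1 \<le> \<epsilon> / 4" "32 * e1 / a \<le> \<epsilon> / 4"
  proof -
    show "0 < e1" using \<epsilon> a(1) by (simp add: e1_def)
    have "e1 \<le> \<epsilon> * a / 128" by (simp add: e1_def)
    then show "32 * e1 / a \<le> \<epsilon> / 4" using a(1) by (simp add: field_simps)
  qed (simp_all add: e1_def)
  obtain \<delta>0 where \<delta>0: "0 < \<delta>0" "L - e1 < ?m \<delta>0"
    using less_cSUP_iff[OF _ bdd, of "L - e1"] e1 by (auto simp: L_def)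
  \<comment> \<open>With 4 \<eta> at most \<open>\<delta>0\<close>, the coarse network still
    competes for the relaxed length at \<open>\<delta>0\<close>.\<close>
  define \<eta> where "\<eta> = min (min 1 (\<delta>0 / 4)) (min (s / 122) (\<epsilon> * s / (4 * N * 122)))"
  have \<eta>: "0 < \<eta>" "\<eta> \<le> 1" "4 * \<eta> \<le> \<delta>0" "122 * \<eta> \<le> s" "N * (122 * \<eta> / s) \<le> \<epsilon> / 4"
  proof -
    show "0 < \<eta>" using \<delta>0 s \<epsilon> N by (auto simp: \<eta>_def)
    have "\<eta> \<le> \<epsilon> * s / (4 * N * 122)" by (simp add: \<eta>_def)
    then show "N * (122 * \<eta> / s) \<le> \<epsilon> / 4" using N s by (simp add: field_simps)
  qed (auto simp: \<eta>_def)
  define \<delta> where "\<delta> = min \<eta> (\<eta>\<^sup>2 / (3 * s))"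
  have \<delta>: "0 < \<delta>" "\<delta> \<le> \<eta>" "3 * s * \<delta> \<le> \<eta>\<^sup>2"
  proof -
    have "\<delta> \<le> \<eta>\<^sup>2 / (3 * s)" by (simp add: \<delta>_def)
    then show "3 * s * \<delta> \<le> \<eta>\<^sup>2" using s by (simp add: field_simps)
  qed (use \<eta> s in \<open>auto simp: \<delta>_def\<close>)
  have "\<delta> \<le> s" using \<delta> \<eta> by linarith
  then have "\<delta>\<^sup>2 \<le> s * \<delta>" using \<delta> by (simp add: power2_eq_square)
  then have \<delta>2: "2 * s * \<delta> + \<delta>\<^sup>2 \<le> \<eta>\<^sup>2" using \<delta> by linarith
  have ne: "{len T | T. mesh_le \<delta> T \<and> covers E (s + \<delta>) T} \<noteq> {}"
    using ex[of 1 \<delta>] \<delta> by auto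
  have "?m \<delta> \<le> L" unfolding L_def using bdd \<delta> by (intro cSUP_upper) auto
  then have "Inf {len T | T. mesh_le \<delta> T \<and> covers E (s + \<delta>) T} < L + e1"
    using e1 unfolding relaxed_length_def by simp
  from cInf_lessD[OF ne this] obtain T where T: "mesh_le \<delta> T" "covers E (s + \<delta>) T" "len T < L + e1"
    by auto
  interpret co: coarsening s \<delta> \<eta> a
    using \<eta> a \<delta> \<delta>2 by unfold_locales auto
  obtain C D where C: "mesh_le (3 * \<eta>) C" "\<And>v. v \<in> verts T \<Longrightarrow> \<exists>c\<in>verts C. dist v c \<le> 3 * \<eta>"
    "\<And>v. v \<in> verts T \<Longrightarrow> co.good v (verts D)" "len C \<le> len T"
    "len D \<le> len C + 16 * ((4 * len T / \<eta> + 1) * co.\<beta> + (len T - len C) / a)"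
    using co.coarsening[OF mesh_le_mono[OF T(1) \<delta>(2)]] by blast
  have "covers E s D"
    using T(2) C(3) unfolding covers_def co.good_def by blast
  moreover have "len D \<le> H + \<epsilon>"
  proof -
    have "covers E (s + \<delta>0) C"
      unfolding covers_def
    proof
      fix e assume "e \<in> E"
      then obtain v where v: "v \<in> verts T" "dist e v \<le> s + \<delta>" using T(2) unfolding covers_def by blast
      then obtain c where c: "c \<in> verts C" "dist v c \<le> 3 * \<eta>" using C(2) by blast
      have "dist e c \<le> s + \<delta>0"
        using dist_triangle[of e c v] v c \<delta> \<eta> by linarith
      then show "\<exists>v\<in>verts C. dist e v \<le> s + \<delta>0" using c by blast
    qed
    moreover have "mesh_le \<delta>0 C" using C(1) \<eta> by (elim mesh_le_mono) linarith
    ultimately have "?m \<delta>0 \<le> len C" by (intro relaxed_length_le)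
    \<comment> \<open>\<open>len T\<close> is below \<open>L + e1\<close> and \<open>len C\<close>
      is above \<open>L - e1\<close>.\<close>
    then have gap: "len T - len C \<le> 2 * e1" using \<delta>0 T by linarith
    have "16 * ((4 * len T / \<eta> + 1) * co.\<beta>) = 16 * (4 * len T + \<eta>) * (a + 122 * \<eta> / s)"
      using \<eta> s unfolding co.\<beta>_def by (simp add: field_simps power2_eq_square)
    also have "\<dots> \<le> N * (a + 122 * \<eta> / s)"
      using T(3) L e1 \<eta> a s by (intro mult_right_mono) (auto simp: N_def)
    also have "\<dots> \<le> \<epsilon> / 2" using a(2) \<eta>(5) by (simp add: distrib_left)
    finally have 1: "16 * ((4 * len T / \<eta> + 1) * co.\<beta>) \<le> \<epsilon> / 2" .
    have "16 * ((len T - len C) / a) \<le> 32 * e1 / a"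
    proof -
      have "16 * ((len T - len C) / a) \<le> 16 * (2 * e1 / a)"
        using gap a(1) by (intro mult_left_mono divide_right_mono) auto
      then show ?thesis by simp
    qed
    then have 2: "16 * ((len T - len C) / a) \<le> \<epsilon> / 4" using e1 by linarith
    have "len D \<le> len C + 16 * ((4 * len T / \<eta> + 1) * co.\<beta>) + 16 * ((len T - len C) / a)"
      using C(5) by (simp only: distrib_left add.assoc)
    then show ?thesis using 1 2 C(4) T(3) L e1 by linarith
  qed
  ultimately show ?thesis by blast
qed

lemma mst_length_le_max_dist_length:
  assumes "compact E" and s: "s > 0"
  shows "mst_length E s \<le> max_dist_length E s"
proof (cases "E = {}")
  \<comment> \<open>An admissible \<open>K\<close> may be empty here and then supplies no vertex; a
    one-point network has length 0.\<close>
  case True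
  then have "mst_length E s \<le> ennreal (len (Point 0 :: (real^2) network))"
    by (intro mst_length_le_len) simp
  then show ?thesis by simp
next
  case False
  show ?thesis
    unfolding max_dist_length_def
  proof (intro INF_greatest, clarify)
    fix K :: "(real^2) set"
    assume K: "closed K" "connected K" "E \<subseteq> closed_nbhd K s"
    show "mst_length E s \<le> hausdorff1 K"
    proof (rule ennreal_le_epsilon)
      fix e :: real assume fin: "hausdorff1 K < top" and e: "0 < e"
      obtain H where H: "0 \<le> H" "hausdorff1 K = ennreal H"
        using fin by (cases "hausdorff1 K") auto
      obtain D where D: "covers E s D" "len D \<le> H + e"
        using covering_network_exists[OF s e H(1)] network_covering[OF assms(1) False K(2,3)] H by (metis order_refl)
      have "E \<subseteq> closed_nbhd (verts D) s"
        using D(1) closed_nbhdI unfolding covers_def by blast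
      then have "mst_length E s \<le> ennreal (len D)" by (rule mst_length_le_len)
      also have "\<dots> \<le> ennreal (H + e)" using D(2) by (rule ennreal_leI)
      also have "\<dots> = hausdorff1 K + ennreal e" using H e by simp
      finally show "mst_length E s \<le> hausdorff1 K + ennreal e" .
    qed
  qed
qed

theorem corollary3p8:
  fixes E :: "(real^2) set" and s :: real
  assumes "compact E" and "s > 0"
  shows "mst_length E s = max_dist_length E s"
  using mst_length_le_max_dist_length[OF assms] max_dist_length_le_mst_length by (rule antisym)

end
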